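(* In $\mathcal A$ we have $$S_{\mathcal A}(1)=\zeta^{(2)}_{\mathcal A}(1)=-\mathtt{q}_2,\qquad \zeta^{(2)}_{\mathcal A}(\bar1)=S_{\mathcal A}(\bar1)=-\tfrac12\mathtt{q}_2,$$ $$t_{\mathcal A}(1)=T_{\mathcal A}(1)=\mathtt{q}_2,\qquad t_{\mathcal A}(\bar1)=T_{\mathcal A}(\bar1)=-\tfrac12(-1)^{p'}\mathtt{q}_2.$$
   Context: Let $\mathcal{P}$ be the set of primes and $\mathcal{A}=\prod_{p\in\mathcal P}(\mathbb{Z}/p\mathbb{Z})\big/\bigoplus_{p\in\mathcal P}(\mathbb{Z}/p\mathbb{Z})$; two families of residues are equal in $\mathcal A$ iff they agree for all but finitely many $p$. $\mathtt{q}_2=\big((2^{p-1}-1)/p\bmod p\big)_{p>2}\in\mathcal A$, and $(-1)^{p'}$ denotes $\big((-1)^{(p-1)/2}\big)_{p\ge3}\in\mathcal A$. Depth one values, as elements of $\mathcal A$ (each sum taken mod $p$): $$S_{\mathcal A}(1)=\zeta^{(2)}_{\mathcal A}(1)=\Big(\sum_{0<k<p,\ 2\mid k}\tfrac1k\Big)_p,\qquad S_{\mathcal A}(\bar1)=\zeta^{(2)}_{\mathcal A}(\bar1)=\Big(\sum_{0<k<p,\ 2\mid k}\tfrac{(-1)^{k/2}}k\Big)_p,$$ $$t_{\mathcal A}(1)=T_{\mathcal A}(1)=\Big(\sum_{0<k<p,\ 2\nmid k}\tfrac1k\Big)_p,\qquad t_{\mathcal A}(\bar1)=T_{\mathcal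 A}(\bar1)=\Big(\sum_{0<k<p,\ 2\nmid k}\tfrac{(-1)^{(k+1)/2}}k\Big)_p.$$ *)

theory Defs
  imports
    Complex_Main
    "HOL-Algebra.QuotRing"
    "HOL-Number_Theory.Residues"
    "HOL-Number_Theory.Modular_Inverse"
begin

definition residue_prod :: "(nat \<Rightarrow> int) ring" where
  "residue_prod =
    \<lparr>carrier = (\<Pi>\<^sub>E p\<in>{p. prime p}. carrier (residue_ring (int p))),
     monoid.mult = \<lambda>f g. \<lambda>p\<in>{p. prime p}. f p \<otimes>\<^bsub>residue_ring (int p)\<^esub> g p,
     one = \<lambda>p\<in>{p. prime p}. \<one>\<^bsub>residue_ring (int p)\<^esub>,
     zero = \<lambda>p\<in>{p. prime p}. \<zero>\<^bsub>residue_ring (int p)\<^esub>,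
     add = \<lambda>f g. \<lambda>p\<in>{p. prime p}. f p \<oplus>\<^bsub>residue_ring (int p)\<^esub> g p\<rparr>"

definition residue_sum :: "(nat \<Rightarrow> int) set" where
  "residue_sum =
    {f \<in> carrier residue_prod. finite {p. prime p \<and> f p \<noteq> \<zero>\<^bsub>residue_ring (int p)\<^esub>}}"

definition ring_A :: "(nat \<Rightarrow> int) set ring" where
  "ring_A = residue_prod Quot residue_sum"

lemma cring_residue_ring: "prime p \<Longrightarrow> cring (residue_ring (int p))"
  using residues.cring[of "int p"] prime_gt_1_nat[of p] by (simp add: residues_def)

lemma cring_residue_prod: "cring residue_prod"
proof -
  note rules = cring.cring_simprules[OF cring_residue_ring]
  have eqI: "f = g" if "f \<in> carrier residue_prod" "g \<in> carrier residue_prod"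
    "\<And>p. prime p \<Longrightarrow> f p = g p" for f g
    using that by (intro PiE_ext[of f "{p. prime p}" _ g]) (auto simp: residue_prod_def)
  have mem: "f p \<in> carrier (residue_ring (int p))" if "f \<in> carrier residue_prod" "prime p" for f p
    using that by (auto simp: residue_prod_def)
  have ac: "f \<oplus>\<^bsub>residue_prod\<^esub> g \<in> carrier residue_prod"
    if "f \<in> carrier residue_prod" "g \<in> carrier residue_prod" for f g
    using mem[OF that(1)] mem[OF that(2)] by (simp add: residue_prod_def rules(1))
  have mc: "f \<otimes>\<^bsub>residue_prod\<^esub> g \<in> carrier residue_prod"
    if "f \<in> carrier residue_prod" "g \<in> carrier residue_prod" for f g
    using mem[OF that(1)] mem[OF that(2)] by (simp add: residue_prod_def rules(5))
  have zc: "\<zero>\<^bsub>residue_prod\<^esub> \<in> carrier residue_prod" and oc: "\<one>\<^bsub>residue_prod\<^esub> \<in> carrier residue_prod"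
    by (simp_all add: residue_prod_def rules(2,6))
  have ev: "(f \<oplus>\<^bsub>residue_prod\<^esub> g) p = f p \<oplus>\<^bsub>residue_ring (int p)\<^esub> g p"
      "(f \<otimes>\<^bsub>residue_prod\<^esub> g) p = f p \<otimes>\<^bsub>residue_ring (int p)\<^esub> g p"
      "\<zero>\<^bsub>residue_prod\<^esub> p = \<zero>\<^bsub>residue_ring (int p)\<^esub>"
      "\<one>\<^bsub>residue_prod\<^esub> p = \<one>\<^bsub>residue_ring (int p)\<^esub>"
    if "prime p" for f g p
    using that by (simp_all add: residue_prod_def)
  have "abelian_group residue_prod"
  proof (rule abelian_groupI)
    fix f assume f: "f \<in> carrier residue_prod"
    define g where "g = (\<lambda>p\<in>{p. prime p}. \<ominus>\<^bsub>residue_ring (int p)\<^esub> f p)"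
    have g: "g \<in> carrier residue_prod"
      using mem[OF f] by (simp add: g_def residue_prod_def rules(3))
    moreover have "g \<oplus>\<^bsub>residue_prod\<^esub> f = \<zero>\<^bsub>residue_prod\<^esub>"
      by (rule eqI[OF ac[OF g f] zc]) (simp add: ev g_def rules(9) mem[OF f])
    ultimately show "\<exists>g\<in>carrier residue_prod. g \<oplus>\<^bsub>residue_prod\<^esub> f = \<zero>\<^bsub>residue_prod\<^esub>"
      by blast
  next
    fix f g assume fg: "f \<in> carrier residue_prod" "g \<in> carrier residue_prod"
    show "f \<oplus>\<^bsub>residue_prod\<^esub> g = g \<oplus>\<^bsub>residue_prod\<^esub> f"
      by (rule eqI[OF ac[OF fg] ac[OF fg(2,1)]]) (simp add: ev rules(10) mem fg)
  qed (auto intro!: ac zc eqI simp: ev mem rules(7,8))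
  moreover have "comm_monoid residue_prod"
  proof (rule comm_monoidI)
    fix f g assume fg: "f \<in> carrier residue_prod" "g \<in> carrier residue_prod"
    show "f \<otimes>\<^bsub>residue_prod\<^esub> g = g \<otimes>\<^bsub>residue_prod\<^esub> f"
      by (rule eqI[OF mc[OF fg] mc[OF fg(2,1)]]) (simp add: ev rules(14) mem fg)
  qed (auto intro!: mc oc eqI simp: ev mem rules(11,12))
  ultimately show ?thesis
    by (rule cringI) (auto intro!: mc ac eqI simp: ev mem rules(13))
qed

lemma a_inv_residue_prod:
  assumes f: "f \<in> carrier residue_prod"
  shows "\<ominus>\<^bsub>residue_prod\<^esub> f = (\<lambda>p\<in>{p. prime p}. \<ominus>\<^bsub>residue_ring (int p)\<^esub> f p)" (is "_ = ?g")
proof -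
  interpret cring residue_prod by (rule cring_residue_prod)
  note rules = cring.cring_simprules[OF cring_residue_ring]
  have mem: "f p \<in> carrier (residue_ring (int p))" if "prime p" for p
    using f that by (auto simp: residue_prod_def)
  have "?g \<in> carrier residue_prod"
    using mem by (simp add: residue_prod_def rules(3))
  moreover have "?g \<oplus>\<^bsub>residue_prod\<^esub> f = \<zero>\<^bsub>residue_prod\<^esub>"
    by (auto simp: residue_prod_def fun_eq_iff rules(9) mem)
  ultimately show ?thesis using f minus_equality by blast
qed

lemma ideal_residue_sum: "ideal residue_sum residue_prod"
proof -
  interpret P: cring residue_prod by (rule cring_residue_prod)
  have l: "g \<otimes>\<^bsub>residue_prod\<^esub> f \<in> residue_sum"
    if f: "f \<in> residue_sum" and g: "g \<in> carrier residue_prod" for f g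
  proof -
    have "(g \<otimes>\<^bsub>residue_prod\<^esub> f) p = \<zero>\<^bsub>residue_ring (int p)\<^esub>"
      if "prime p" "f p = \<zero>\<^bsub>residue_ring (int p)\<^esub>" for p
      using that by (auto simp: residue_prod_def residue_ring_def)
    hence sub: "{p. prime p \<and> (g \<otimes>\<^bsub>residue_prod\<^esub> f) p \<noteq> \<zero>\<^bsub>residue_ring (int p)\<^esub>}
            \<subseteq> {p. prime p \<and> f p \<noteq> \<zero>\<^bsub>residue_ring (int p)\<^esub>}"
      by blast
    show ?thesis
      using finite_subset[OF sub] f g by (simp add: residue_sum_def)
  qed
  have a: "f \<oplus>\<^bsub>residue_prod\<^esub> g \<in> residue_sum"
    if f: "f \<in> residue_sum" and g: "g \<in> residue_sum" for f g
  proof -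
    have sub: "{p. prime p \<and> (f \<oplus>\<^bsub>residue_prod\<^esub> g) p \<noteq> \<zero>\<^bsub>residue_ring (int p)\<^esub>}
            \<subseteq> {p. prime p \<and> f p \<noteq> \<zero>\<^bsub>residue_ring (int p)\<^esub>}
              \<union> {p. prime p \<and> g p \<noteq> \<zero>\<^bsub>residue_ring (int p)\<^esub>}"
      by (auto simp: residue_prod_def residue_ring_def)
    show ?thesis
      using finite_subset[OF sub] f g by (simp add: residue_sum_def)
  qed
  have m: "\<ominus>\<^bsub>residue_prod\<^esub> f \<in> residue_sum" if f: "f \<in> residue_sum" for f
  proof -
    have "f = \<one>\<^bsub>residue_prod\<^esub> \<otimes>\<^bsub>residue_prod\<^esub> f" and fc: "f \<in> carrier residue_prod"
      using f by (auto simp: residue_sum_def)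
    hence "\<ominus>\<^bsub>residue_prod\<^esub> f = (\<ominus>\<^bsub>residue_prod\<^esub> \<one>\<^bsub>residue_prod\<^esub>) \<otimes>\<^bsub>residue_prod\<^esub> f"
      by (metis P.l_minus P.one_closed)
    with l[OF f] show ?thesis by simp
  qed
  show ?thesis
  proof (rule idealI)
    show "subgroup residue_sum (add_monoid residue_prod)"
    proof (rule P.add.subgroupI)
      show "residue_sum \<noteq> {}"
      proof -
        have "{p. prime p \<and> \<zero>\<^bsub>residue_prod\<^esub> p \<noteq> \<zero>\<^bsub>residue_ring (int p)\<^esub>} = {}"
          by (auto simp: residue_prod_def)
        hence "\<zero>\<^bsub>residue_prod\<^esub> \<in> residue_sum"
          unfolding residue_sum_def by (simp del: Collect_empty_eq)
        thus ?thesis by blast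
      qed
      show "residue_sum \<subseteq> carrier residue_prod"
        by (auto simp: residue_sum_def)
    qed (use a m in \<open>simp_all add: a_inv_def\<close>)
  next
    fix f g assume "f \<in> residue_sum" "g \<in> carrier residue_prod"
    moreover from this have "f \<otimes>\<^bsub>residue_prod\<^esub> g = g \<otimes>\<^bsub>residue_prod\<^esub> f"
      by (intro P.m_comm) (auto simp: residue_sum_def)
    ultimately show "g \<otimes>\<^bsub>residue_prod\<^esub> f \<in> residue_sum" "f \<otimes>\<^bsub>residue_prod\<^esub> g \<in> residue_sum"
      using l by simp_all
  qed (rule P.ring_axioms)
qed

lemma cring_ring_A: "cring ring_A"
  unfolding ring_A_def
  by (rule ideal.quotient_is_cring[OF ideal_residue_sum cring_residue_prod])

text \<open>
  The residue modulo \<open>p\<close> of a rational number whose denominator is prime to \<open>p\<close>; if \<open>p\<close> divides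
  the reduced denominator the value is \<open>0\<close>, as \<^const>\<open>modular_inverse\<close> is then \<open>0\<close>.
\<close>
definition rat_mod :: "nat \<Rightarrow> rat \<Rightarrow> int" where
  "rat_mod p r =
    (case quotient_of r of (a, b) \<Rightarrow> (a * modular_inverse (int p) b) mod int p)"

lemma rat_mod_carrier: "p > 1 \<Longrightarrow> rat_mod p r \<in> carrier (residue_ring (int p))"
  by (auto simp: rat_mod_def residue_ring_def split: prod.splits)

lemma cong_rat_mod:
  assumes "prime p" and "\<not> int p dvd b"
  shows "[b * rat_mod p (of_int a / of_int b) = a] (mod int p)"
proof -
  obtain c d where q: "quotient_of (of_int a / of_int b :: rat) = (c, d)" by fastforce
  have d: "d > 0" and cop: "coprime c d" and b0: "b \<noteq> 0"
    using q assms(2) by (auto intro: quotient_of_denom_pos quotient_of_coprime)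
  have "of_int a / of_int b = (of_int c / of_int d :: rat)" using quotient_of_div[OF q] .
  hence "(of_int (a * d) :: rat) = of_int (c * b)" using d b0 by (simp add: field_simps)
  hence ad: "a * d = c * b" by (simp only: of_int_eq_iff)
  hence "d dvd b" using cop by (metis coprime_commute coprime_dvd_mult_right_iff dvd_triv_right)
  hence nd: "\<not> int p dvd d" using assms(2) dvd_trans by blast
  have p: "prime (int p)" using assms(1) by simp
  have cd: "coprime d (int p)" using prime_imp_coprime[OF p nd] by (simp add: coprime_commute)
  have "[d * (b * rat_mod p (of_int a / of_int b)) = d * (b * (c * modular_inverse (int p) d))] (mod int p)"
    by (intro cong_mult cong_refl) (simp add: rat_mod_def q cong_def)
  also have "d * (b * (c * modular_inverse (int p) d)) = (b * c) * (d * modular_inverse (int p) d)"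
    by (simp add: ac_simps)
  also have "[\<dots> = (b * c) * 1] (mod int p)"
    by (intro cong_mult cong_refl cong_modular_inverse1 cd)
  also have "(b * c) * 1 = d * a" using ad by (simp add: ac_simps)
  finally show ?thesis using cd cong_mult_lcancel by blast
qed

text \<open>
  The class in \<open>ring_A\<close> of a family of rationals reduced modulo each prime. Finitely many primes,
  such as \<open>p = 2\<close> below, do not affect it.
\<close>
definition class_A :: "(nat \<Rightarrow> rat) \<Rightarrow> (nat \<Rightarrow> int) set" where
  "class_A f = residue_sum +>\<^bsub>residue_prod\<^esub> (\<lambda>p\<in>{p. prime p}. rat_mod p (f p))"

lemma class_A_carrier: "class_A f \<in> carrier ring_A"
proof -
  have "(\<lambda>p\<in>{p. prime p}. rat_mod p (f p)) \<in> carrier residue_prod"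
    using rat_mod_carrier prime_gt_1_nat by (auto simp: residue_prod_def)
  thus ?thesis by (auto simp: class_A_def ring_A_def FactRing_def A_RCOSETS_def RCOSETS_def a_r_coset_def)
qed

lemma class_A_eq_iff:
  "class_A f = class_A g \<longleftrightarrow> finite {p. prime p \<and> rat_mod p (f p) \<noteq> rat_mod p (g p)}"
proof -
  interpret I: ideal residue_sum residue_prod by (rule ideal_residue_sum)
  let ?f = "\<lambda>p\<in>{p. prime p}. rat_mod p (f p)" and ?g = "\<lambda>p\<in>{p. prime p}. rat_mod p (g p)"
  have c: "?f \<in> carrier residue_prod" "?g \<in> carrier residue_prod"
    using rat_mod_carrier prime_gt_1_nat by (auto simp: residue_prod_def)
  have "class_A f = class_A g \<longleftrightarrow> ?f \<ominus>\<^bsub>residue_prod\<^esub> ?g \<in> residue_sum"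
  proof
    assume "class_A f = class_A g"
    hence "?f \<in> residue_sum +>\<^bsub>residue_prod\<^esub> ?g"
      unfolding class_A_def using I.a_rcos_self[OF c(1)] by simp
    thus "?f \<ominus>\<^bsub>residue_prod\<^esub> ?g \<in> residue_sum"
      using I.a_rcos_module_minus[OF I.ring_axioms c(2,1)] by simp
  next
    assume "?f \<ominus>\<^bsub>residue_prod\<^esub> ?g \<in> residue_sum"
    hence "?f \<in> residue_sum +>\<^bsub>residue_prod\<^esub> ?g"
      using I.a_rcos_module_minus[OF I.ring_axioms c(2,1)] by simp
    thus "class_A f = class_A g"
      unfolding class_A_def using I.a_repr_independence'[OF _ c(2)] by simp
  qed
  also have "\<dots> \<longleftrightarrow> finite {p. prime p \<and> rat_mod p (f p) \<noteq> rat_mod p (g p)}"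
  proof -
    define d where "d = ?f \<ominus>\<^bsub>residue_prod\<^esub> ?g"
    have "d p = \<zero>\<^bsub>residue_ring (int p)\<^esub> \<longleftrightarrow> rat_mod p (f p) = rat_mod p (g p)"
      if p: "prime p" for p
    proof -
      interpret R: cring "residue_ring (int p)" by (rule cring_residue_ring[OF p])
      have "d p = rat_mod p (f p) \<ominus>\<^bsub>residue_ring (int p)\<^esub> rat_mod p (g p)"
        unfolding d_def using p by (simp add: a_minus_def a_inv_residue_prod[OF c(2)])
          (simp add: residue_prod_def)
      moreover have "rat_mod p r \<in> carrier (residue_ring (int p))" for r
        by (intro rat_mod_carrier prime_gt_1_nat p)
      ultimately show ?thesis by simp
    qed
    hence eq: "{p. prime p \<and> d p \<noteq> \<zero>\<^bsub>residue_ring (int p)\<^esub>} =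
            {p. prime p \<and> rat_mod p (f p) \<noteq> rat_mod p (g p)}" by blast
    have "d \<in> carrier residue_prod"
      unfolding d_def by (intro I.minus_closed c)
    hence "d \<in> residue_sum \<longleftrightarrow> finite {p. prime p \<and> d p \<noteq> \<zero>\<^bsub>residue_ring (int p)\<^esub>}"
      unfolding residue_sum_def by blast
    thus ?thesis unfolding eq unfolding d_def .
  qed
  finally show ?thesis .
qed

text \<open>The rational \<open>r\<close> as an element of the \<open>\<rat>\<close>-algebra \<open>ring_A\<close>.\<close>
definition rat_A :: "rat \<Rightarrow> (nat \<Rightarrow> int) set" where
  "rat_A r = class_A (\<lambda>_. r)"

definition q2_A :: "(nat \<Rightarrow> int) set" where
  "q2_A = class_A (\<lambda>p. (2 ^ (p - 1) - 1) / of_nat p)"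

definition sign_A :: "(nat \<Rightarrow> int) set" where
  "sign_A = class_A (\<lambda>p. (- 1) ^ ((p - 1) div 2))"

text \<open>
  The suffix \<open>bar1\<close> denotes the index with a bar. In depth one the values \<open>S\<close> and \<open>zeta2\<close>
  (respectively \<open>t\<close> and \<open>T\<close>) are given by the same sums.
\<close>
definition S_A_1 :: "(nat \<Rightarrow> int) set" where
  "S_A_1 = class_A (\<lambda>p. \<Sum>k | 0 < k \<and> k < p \<and> even k. 1 / of_nat k)"

definition zeta2_A_1 :: "(nat \<Rightarrow> int) set" where
  "zeta2_A_1 = class_A (\<lambda>p. \<Sum>k | 0 < k \<and> k < p \<and> even k. 1 / of_nat k)"

definition S_A_bar1 :: "(nat \<Rightarrow> int) set" where
  "S_A_bar1 = class_A (\<lambda>p. \<Sum>k | 0 < k \<and> k < p \<and> even k. (- 1) ^ (k div 2) / of_nat k)"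

definition zeta2_A_bar1 :: "(nat \<Rightarrow> int) set" where
  "zeta2_A_bar1 = class_A (\<lambda>p. \<Sum>k | 0 < k \<and> k < p \<and> even k. (- 1) ^ (k div 2) / of_nat k)"

definition t_A_1 :: "(nat \<Rightarrow> int) set" where
  "t_A_1 = class_A (\<lambda>p. \<Sum>k | 0 < k \<and> k < p \<and> odd k. 1 / of_nat k)"

definition T_A_1 :: "(nat \<Rightarrow> int) set" where
  "T_A_1 = class_A (\<lambda>p. \<Sum>k | 0 < k \<and> k < p \<and> odd k. 1 / of_nat k)"

definition t_A_bar1 :: "(nat \<Rightarrow> int) set" where
  "t_A_bar1 = class_A (\<lambda>p. \<Sum>k | 0 < k \<and> k < p \<and> odd k. (- 1) ^ ((k + 1) div 2) / of_nat k)"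

definition T_A_bar1 :: "(nat \<Rightarrow> int) set" where
  "T_A_bar1 = class_A (\<lambda>p. \<Sum>k | 0 < k \<and> k < p \<and> odd k. (- 1) ^ ((k + 1) div 2) / of_nat k)"

end

theory Submission
  imports Defs
begin

text \<open>
  Modulo \<open>p\<close> one has \<open>(p choose k) / p = (-1)^(k-1) / k\<close>, so a sum of \<open>c k / k\<close> over the even
  (or odd) \<open>k\<close> below \<open>p\<close> is, up to sign, a binomial sum without its end term, divided by \<open>p\<close>. For
  \<open>c = 1\<close> the full binomial sum is \<open>2^(p-1)\<close>. For the alternating signs it is the real or imaginary
  part of \<open>(1 + \<i>)^p\<close>, whose square is \<open>2^(p-1)\<close>; since it has the form \<open>e + p Y\<close> with
  \<open>e = \<plusminus>1\<close>, the Fermat quotient is \<open>2 e Y\<close> modulo \<open>p\<close>. Working with the square avoids the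
  sign of the root, i.e. the quadratic character of 2.
\<close>

section \<open>Rationals integral at a prime\<close>

text \<open>For prime \<open>p\<close> this is the localization of the integers at \<open>p\<close>.
  The fraction need not be in lowest terms, so closure under the ring operations only multiplies
  denominators.\<close>

definition integral_at :: "nat \<Rightarrow> rat set" where
  "integral_at p = {of_int a / of_int b |a b. \<not> int p dvd b}"

lemma integral_atE:
  assumes "r \<in> integral_at p"
  obtains a b where "r = of_int a / of_int b" "\<not> int p dvd b" "b \<noteq> 0"
  using assms unfolding integral_at_def by force

lemma integral_at_divide: "\<not> int p dvd b \<Longrightarrow> of_int a / of_int b \<in> integral_at p"
  unfolding integral_at_def by blast

lemma integral_at_of_int:
  assumes "prime p"
  shows "of_int a \<in> integral_at p"
proof -
  have "\<not> int p dvd 1" using assms by auto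
  from integral_at_divide[OF this, of a] show ?thesis by simp
qed

lemma integral_at_add:
  assumes p: "prime p" and r: "r \<in> integral_at p" and s: "s \<in> integral_at p"
  shows "r + s \<in> integral_at p"
proof -
  obtain a b where r: "r = of_int a / of_int b" "\<not> int p dvd b" "b \<noteq> 0" by (rule integral_atE[OF r])
  obtain c d where s: "s = of_int c / of_int d" "\<not> int p dvd d" "d \<noteq> 0" by (rule integral_atE[OF s])
  have "\<not> int p dvd b * d" using r s p by (simp add: prime_dvd_mult_iff)
  moreover have "r + s = of_int (a * d + c * b) / of_int (b * d)"
    using r s by (simp add: field_simps)
  ultimately show ?thesis using integral_at_divide by metis
qed

lemma integral_at_mult:
  assumes p: "prime p" and r: "r \<in> integral_at p" and s: "s \<in> integral_at p"
  shows "r * s \<in> integral_at p"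
proof -
  obtain a b where r: "r = of_int a / of_int b" "\<not> int p dvd b" by (rule integral_atE[OF r])
  obtain c d where s: "s = of_int c / of_int d" "\<not> int p dvd d" by (rule integral_atE[OF s])
  have "\<not> int p dvd b * d" using r s p by (simp add: prime_dvd_mult_iff)
  moreover have "r * s = of_int (a * c) / of_int (b * d)"
    using r s by simp
  ultimately show ?thesis using integral_at_divide by metis
qed

lemma integral_at_uminus:
  assumes "r \<in> integral_at p"
  shows "- r \<in> integral_at p"
proof -
  obtain a b where "r = of_int a / of_int b" "\<not> int p dvd b" by (rule integral_atE[OF assms])
  then show ?thesis using integral_at_divide[of p b "- a"] by simp
qed

lemma integral_at_sum:
  assumes "prime p" and "\<And>k. k \<in> K \<Longrightarrow> f k \<in> integral_at p"
  shows "sum f K \<in> integral_at p"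
  using assms(2)
  by (induction K rule: infinite_finite_induct)
    (use assms(1) integral_at_of_int[of p 0] in \<open>auto intro: integral_at_add\<close>)

text \<open>\<open>rat_mod\<close> is defined through the reduced fraction. Since \<open>b\<close>
  is a unit modulo \<open>p\<close>, any fraction with such a denominator fixes the same residue,
  and lowest terms need not be computed again.\<close>

lemma rat_mod_eqI:
  assumes p: "prime p" and b: "\<not> int p dvd b"
    and r: "r = of_int a / of_int b" and m: "[b * m = a] (mod int p)"
  shows "rat_mod p r = m mod int p"
proof -
  have "[b * rat_mod p r = b * m] (mod int p)"
    using cong_rat_mod[OF p b, of a] m r cong_sym cong_trans by blast
  moreover have "coprime b (int p)"
    using prime_imp_coprime[of "int p" b] p b by (simp add: coprime_commute)
  ultimately have "[rat_mod p r = m] (mod int p)" using cong_mult_lcancel by blast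
  then show ?thesis
    using rat_mod_carrier[OF prime_gt_1_nat[OF p], of r] by (simp add: cong_def residue_ring_def)
qed

lemma rat_mod_uminus:
  assumes p: "prime p" and r: "r \<in> integral_at p"
  shows "rat_mod p (- r) = (- rat_mod p r) mod int p"
proof -
  obtain a b where r: "r = of_int a / of_int b" "\<not> int p dvd b" by (rule integral_atE[OF r])
  have "[b * (- rat_mod p r) = - a] (mod int p)"
    using cong_rat_mod[OF p r(2), of a] r(1) by (simp add: cong_minus_minus_iff)
  then show ?thesis using r by (intro rat_mod_eqI[OF p r(2), of _ "- a"]) simp_all
qed

lemma rat_mod_mult:
  assumes p: "prime p" and r: "r \<in> integral_at p" and s: "s \<in> integral_at p"
  shows "rat_mod p (r * s) = (rat_mod p r * rat_mod p s) mod int p"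
proof -
  obtain a b where r: "r = of_int a / of_int b" "\<not> int p dvd b" by (rule integral_atE[OF r])
  obtain c d where s: "s = of_int c / of_int d" "\<not> int p dvd d" by (rule integral_atE[OF s])
  have "\<not> int p dvd b * d" using r s p by (simp add: prime_dvd_mult_iff)
  moreover have "[(b * rat_mod p r) * (d * rat_mod p s) = a * c] (mod int p)"
    using cong_rat_mod[OF p r(2), of a] cong_rat_mod[OF p s(2), of c] r(1) s(1)
    by (simp add: cong_mult)
  ultimately show ?thesis
    using r s by (intro rat_mod_eqI[OF p, of "b * d" _ "a * c"]) (simp_all add: ac_simps)
qed

text \<open>Integrality of the difference after division by \<open>p\<close> plays the part of
  congruence modulo \<open>p\<close> for rationals; the harmonic sum lemmas below are stated in this
  form. Over the denominator \<open>b * d\<close> the numerator of \<open>r\<close> is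
  \<open>a * d\<close> plus a multiple of \<open>p\<close>, which leaves the residue
  unchanged.\<close>

lemma rat_mod_cong:
  assumes p: "prime p" and s: "s \<in> integral_at p" and d: "(r - s) / of_nat p \<in> integral_at p"
  shows "rat_mod p r = rat_mod p s"
proof -
  obtain a b where s: "s = of_int a / of_int b" "\<not> int p dvd b" "b \<noteq> 0" by (rule integral_atE[OF s])
  obtain c d where d: "(r - s) / of_nat p = of_int c / of_int d" "\<not> int p dvd d" "d \<noteq> 0"
    by (rule integral_atE[OF d])
  have nd: "\<not> int p dvd b * d" using s d p by (simp add: prime_dvd_mult_iff)
  have "(of_nat p :: rat) \<noteq> 0" using p by auto
  then have "r = s + of_nat p * (of_int c / of_int d)"
    using d(1) by (simp add: field_simps)
  then have r: "r = of_int (a * d + int p * (b * c)) / of_int (b * d)"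
    unfolding s(1) using s(3) d(3) by (simp add: field_simps)
  have "[d * (b * rat_mod p s) = d * a] (mod int p)"
    using cong_rat_mod[OF p s(2), of a] s(1) by (simp add: cong_mult)
  then have "[b * d * rat_mod p s = a * d + int p * (b * c)] (mod int p)"
    unfolding cong_def mod_mult_self2 by (simp add: ac_simps)
  then have "rat_mod p r = rat_mod p s mod int p" by (rule rat_mod_eqI[OF p nd r])
  then show ?thesis
    using rat_mod_carrier[OF prime_gt_1_nat[OF p], of s] by (simp add: residue_ring_def)
qed

section \<open>Classes of families of integral rationals\<close>

text \<open>Only finitely many primes are at most 2, so the class ignores them. This makes 2 a unit
  at every prime considered.\<close>

lemma class_A_eqI:
  assumes "\<And>p. prime p \<Longrightarrow> p > 2 \<Longrightarrow> g p \<in> integral_at p"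
    and "\<And>p. prime p \<Longrightarrow> p > 2 \<Longrightarrow> (f p - g p) / of_nat p \<in> integral_at p"
  shows "class_A f = class_A g"
proof -
  have "rat_mod p (f p) = rat_mod p (g p)" if "prime p" "p > 2" for p
    using that by (intro rat_mod_cong assms)
  then have "{p. prime p \<and> rat_mod p (f p) \<noteq> rat_mod p (g p)} \<subseteq> {..2}"
    by (auto intro: leI)
  then show ?thesis using class_A_eq_iff finite_subset by blast
qed

lemma rat_mod_of_int:
  assumes "prime p"
  shows "rat_mod p (of_int a) = a mod int p"
proof -
  have "\<not> int p dvd 1" using assms by auto
  then show ?thesis by (intro rat_mod_eqI[OF assms, of 1 _ a]) simp_all
qed

text \<open>The quotient map is a ring homomorphism, so it remains to compare representatives.
  \<open>rat_mod\<close> respects products at \<open>p\<close> when both factors are integral there,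
  hence the two assumptions.\<close>

lemma class_A_mult:
  assumes "\<And>p. prime p \<Longrightarrow> p > 2 \<Longrightarrow> f p \<in> integral_at p"
    and "\<And>p. prime p \<Longrightarrow> p > 2 \<Longrightarrow> g p \<in> integral_at p"
  shows "class_A f \<otimes>\<^bsub>ring_A\<^esub> class_A g = class_A (\<lambda>p. f p * g p)"
proof -
  interpret I: ideal residue_sum residue_prod by (rule ideal_residue_sum)
  let ?r = "\<lambda>f. \<lambda>p\<in>{p. prime p}. rat_mod p (f p)"
  have c: "?r h \<in> carrier residue_prod" for h
    using rat_mod_carrier prime_gt_1_nat by (auto simp: residue_prod_def)
  \<comment> \<open>Reading the product of residues as a rational family makes its class a
    \<open>class_A\<close> again, so that \<open>class_A_eq_iff\<close> applies.\<close>
  have "?r f \<otimes>\<^bsub>residue_prod\<^esub> ?r g = ?r (\<lambda>p. of_int (rat_mod p (f p) * rat_mod p (g p)))"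
    by (simp add: residue_prod_def residue_ring_def rat_mod_of_int fun_eq_iff del: of_int_mult)
  then have "class_A f \<otimes>\<^bsub>ring_A\<^esub> class_A g = class_A (\<lambda>p. of_int (rat_mod p (f p) * rat_mod p (g p)))"
    unfolding class_A_def ring_A_def by (simp add: ring_hom_mult[OF I.rcos_ring_hom c c, symmetric])
  also have "\<dots> = class_A (\<lambda>p. f p * g p)"
    unfolding class_A_eq_iff
    by (rule finite_subset[of _ "{..2}"])
      (use assms in \<open>auto simp: rat_mod_of_int rat_mod_mult simp del: of_int_mult intro: leI\<close>)
  finally show ?thesis .
qed

lemma class_A_uminus:
  assumes "\<And>p. prime p \<Longrightarrow> p > 2 \<Longrightarrow> f p \<in> integral_at p"
  shows "\<ominus>\<^bsub>ring_A\<^esub> class_A f = class_A (\<lambda>p. - f p)"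
proof -
  interpret I: ideal residue_sum residue_prod by (rule ideal_residue_sum)
  let ?r = "\<lambda>p\<in>{p. prime p}. rat_mod p (f p)"
  have c: "?r \<in> carrier residue_prod"
    using rat_mod_carrier prime_gt_1_nat by (auto simp: residue_prod_def)
  have neg: "\<ominus>\<^bsub>residue_ring (int p)\<^esub> a = (- a) mod int p" if "prime p" "a \<in> carrier (residue_ring (int p))" for p a
    using residues.res_neg_eq[of "int p"] prime_gt_1_nat[OF that(1)] by (simp add: residues_def)
  have "\<ominus>\<^bsub>residue_prod\<^esub> ?r = (\<lambda>p\<in>{p. prime p}. rat_mod p (of_int (- rat_mod p (f p))))"
    unfolding a_inv_residue_prod[OF c]
    by (simp add: rat_mod_of_int fun_eq_iff neg[OF _ rat_mod_carrier[OF prime_gt_1_nat]] del: of_int_minus)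
  then have "\<ominus>\<^bsub>ring_A\<^esub> class_A f = class_A (\<lambda>p. of_int (- rat_mod p (f p)))"
    using ring_hom_cring.hom_a_inv[OF ring_hom_cringI[OF cring_residue_prod cring_ring_A[unfolded ring_A_def] I.rcos_ring_hom] c]
    unfolding class_A_def ring_A_def by simp
  also have "\<dots> = class_A (\<lambda>p. - f p)"
    unfolding class_A_eq_iff
    by (rule finite_subset[of _ "{..2}"])
      (use assms in \<open>auto simp: rat_mod_of_int rat_mod_uminus simp del: of_int_minus intro: leI\<close>)
  finally show ?thesis .
qed

section \<open>Binomial coefficients modulo a prime\<close>

text \<open>By Pascal's rule two neighbouring entries of row \<open>p - 1\<close> add up to an inner
  entry of row \<open>p\<close>, which \<open>p\<close> divides. Hence the entries alternate in sign
  modulo \<open>p\<close>, starting from 1.\<close>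

lemma prime_choose_minus_one:
  assumes "prime p" "j < p"
  shows "[int ((p - 1) choose j) = (- 1) ^ j] (mod int p)"
  using assms(2)
proof (induction j)
  case (Suc j)
  have "p choose Suc j = ((p - 1) choose j) + ((p - 1) choose Suc j)"
    using assms by (cases p) simp_all
  moreover have "int p dvd int (p choose Suc j)"
    using dvd_choose_prime[of "Suc j" p] assms Suc.prems by simp
  ultimately have "[int ((p - 1) choose j) + int ((p - 1) choose Suc j) = 0] (mod int p)"
    by (simp add: cong_0_iff)
  moreover have "[int ((p - 1) choose j) = (- 1) ^ j] (mod int p)" using Suc by simp
  ultimately have "[int ((p - 1) choose j) + int ((p - 1) choose Suc j) - int ((p - 1) choose j)
    = 0 - (- 1) ^ j] (mod int p)"
    by (rule cong_diff)
  then show ?case by simp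
qed simp

text \<open>Absorption, \<open>k * (p choose k) = p * ((p - 1) choose (k - 1))\<close>, reduces each
  term to the residue of row \<open>p - 1\<close>. The weights \<open>c\<close> stay arbitrary to
  cover both constant and alternating signs.\<close>

lemma sum_choose_divide_prime:
  fixes c :: "nat \<Rightarrow> int"
  assumes p: "prime p" and K: "K \<subseteq> {0<..<p}"
  shows "((\<Sum>k\<in>K. of_int (c k) * of_nat (p choose k) / of_nat p)
    - (\<Sum>k\<in>K. of_int (c k) * (- 1) ^ (k - 1) / of_nat k)) / of_nat p \<in> integral_at p"
proof -
  have "(of_int (c k) * of_nat (p choose k) / of_nat p - of_int (c k) * (- 1) ^ (k - 1) / of_nat k)
      / of_nat p \<in> integral_at p" if "k \<in> K" for k
  proof -
    have k: "0 < k" "k < p" using K that by auto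
    have "int p dvd int ((p - 1) choose (k - 1)) - (- 1) ^ (k - 1)"
      using prime_choose_minus_one[OF p, of "k - 1"] k by (simp add: cong_iff_dvd_diff)
    then obtain u where u: "int ((p - 1) choose (k - 1)) - (- 1) ^ (k - 1) = int p * u" by blast
    have "(of_nat ((p - 1) choose (k - 1)) :: rat) = (- 1) ^ (k - 1) + of_nat p * of_int u"
      using arg_cong[OF u, of "of_int :: int \<Rightarrow> rat"] by (simp add: algebra_simps)
    moreover have "of_nat k * of_nat (p choose k) = (of_nat p * of_nat ((p - 1) choose (k - 1)) :: rat)"
      using times_binomial_minus1_eq[OF k(1), of p] by (metis of_nat_mult)
    ultimately have "of_nat (p choose k) / of_nat p
      = ((- 1) ^ (k - 1) + of_nat p * of_int u) / (of_nat k :: rat)"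
      using k by (simp add: frac_eq_eq mult.commute)
    then have "of_int (c k) * of_nat (p choose k) / of_nat p
      = of_int (c k) * (((- 1) ^ (k - 1) + of_nat p * of_int u) / (of_nat k :: rat))"
      by (metis times_divide_eq_right)
    \<comment> \<open>The error term is \<open>c k * u / k\<close>, integral at \<open>p\<close>
      because \<open>0 < k < p\<close>.\<close>
    then have "(of_int (c k) * of_nat (p choose k) / of_nat p
        - of_int (c k) * (- 1) ^ (k - 1) / of_nat k) / of_nat p
      = of_int (c k * u) / (of_int (int k) :: rat)"
      using k by (simp add: field_simps)
    moreover have "\<not> int p dvd int k" using k by (auto dest: dvd_imp_le)
    ultimately show ?thesis using integral_at_divide by metis
  qed
  then show ?thesis
    unfolding sum_subtractf[symmetric] sum_divide_distrib by (intro integral_at_sum[OF p])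
qed

section \<open>Alternating binomial sums by parity\<close>

lemma imaginary_unit_power:
  "Re (\<i> ^ k) = (if even k then (- 1) ^ (k div 2) else 0)"
  "Im (\<i> ^ k) = (if odd k then (- 1) ^ (k div 2) else 0)"
  by (cases "even k"; elim evenE oddE; simp add: power_mult)+

text \<open>The sums are the real and imaginary parts of \<open>(1 + \<i>) ^ n\<close>. As
  \<open>(1 + \<i>)\<^sup>2 = 2 * \<i>\<close> and \<open>n\<close> is odd, this power is
  \<open>2 ^ m * \<i> ^ m * (1 + \<i>)\<close>, and both its parts are \<open>2 ^ m\<close> up to
  sign.\<close>

lemma alternating_binomial_sum_squared:
  fixes m :: nat
  defines "n \<equiv> 2 * m + 1"
  shows "(\<Sum>k | k \<le> n \<and> even k. (- 1) ^ (k div 2) * int (n choose k))\<^sup>2 = 2 ^ (n - 1)" (is "?E\<^sup>2 = _")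
    and "(\<Sum>k | k \<le> n \<and> odd k. (- 1) ^ (k div 2) * int (n choose k))\<^sup>2 = 2 ^ (n - 1)" (is "?O\<^sup>2 = _")
proof -
  have b: "(1 + \<i>) ^ n = (\<Sum>k\<le>n. of_nat (n choose k) * \<i> ^ k)"
    using binomial_ring[of \<i> 1 n] by (simp add: add.commute)
  \<comment> \<open>Powers of the wrong parity contribute zero to the real part, and likewise to the
    imaginary part below, so the sum shrinks to one parity class.\<close>
  have E: "Re ((1 + \<i>) ^ n) = of_int ?E"
    unfolding b by (auto simp: imaginary_unit_power split: if_splits intro!: sum.mono_neutral_cong_right)
  have O: "Im ((1 + \<i>) ^ n) = of_int ?O"
    unfolding b by (auto simp: imaginary_unit_power split: if_splits intro!: sum.mono_neutral_cong_right)
  have "(1 + \<i>)\<^sup>2 = 2 * \<i>" by (simp add: power2_eq_square algebra_simps)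
  then have "(1 + \<i>) ^ n = of_real (2 ^ m) * (\<i> ^ m * (1 + \<i>))"
    by (simp add: n_def power_mult power_mult_distrib)
  moreover have "1 + \<i> \<noteq> 0" by (simp add: complex_eq_iff)
  ultimately have "(Re ((1 + \<i>) ^ n))\<^sup>2 = 2 ^ (n - 1)" "(Im ((1 + \<i>) ^ n))\<^sup>2 = 2 ^ (n - 1)"
    by (auto simp: imaginary_unit_power n_def power_mult_distrib simp flip: power_mult
        simp: mult.commute[of m])
  then have "real_of_int (?E\<^sup>2) = of_int (2 ^ (n - 1))" "real_of_int (?O\<^sup>2) = of_int (2 ^ (n - 1))"
    unfolding E O by simp_all
  then show "?E\<^sup>2 = 2 ^ (n - 1)" "?O\<^sup>2 = 2 ^ (n - 1)" by (simp_all only: of_int_eq_iff)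
qed

lemma finite_interval_Collect: "finite {k. 0 < k \<and> k < n \<and> P k}" for n :: nat
  by (rule finite_subset[of _ "{..<n}"]) auto

text \<open>Since \<open>p\<close> is odd, the only end of row \<open>p\<close> with even index is
  \<open>k = 0\<close>.\<close>

lemma sum_even_choose_prime:
  fixes c :: "nat \<Rightarrow> int"
  assumes p: "prime p" "p > 2"
  shows "(\<Sum>k | k \<le> p \<and> even k. c k * int (p choose k))
    = c 0 + (\<Sum>k | 0 < k \<and> k < p \<and> even k. c k * int (p choose k))"
proof -
  have "odd p" using p by (simp add: prime_odd_nat)
  then have "{k. k \<le> p \<and> even k} = insert 0 {k. 0 < k \<and> k < p \<and> even k}"
    by (auto simp: le_less)
  then show ?thesis by (simp add: finite_interval_Collect)
qed

text \<open>Here the surviving end is \<open>k = p\<close>; with alternating weights its coefficient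
  \<open>c p\<close> is the source of the factor \<open>sign_A\<close>.\<close>

lemma sum_odd_choose_prime:
  fixes c :: "nat \<Rightarrow> int"
  assumes p: "prime p" "p > 2"
  shows "(\<Sum>k | k \<le> p \<and> odd k. c k * int (p choose k))
    = c p + (\<Sum>k | 0 < k \<and> k < p \<and> odd k. c k * int (p choose k))"
proof -
  have "odd p" using p by (simp add: prime_odd_nat)
  then have "{k. k \<le> p \<and> odd k} = insert p {k. 0 < k \<and> k < p \<and> odd k}"
    by (auto simp: le_less intro: odd_pos)
  then show ?thesis by (simp add: finite_interval_Collect)
qed

text \<open>For even \<open>k > 0\<close> the sign \<open>(- 1) ^ (k - 1)\<close> is -1, hence the
  plus between the two sums; for odd \<open>k\<close> it is 1, hence the minus in the odd
  counterpart.\<close>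

lemma even_harmonic_sum_cong:
  fixes c :: "nat \<Rightarrow> int"
  assumes "prime p"
  shows "((\<Sum>k | 0 < k \<and> k < p \<and> even k. of_int (c k) / of_nat k)
    + of_int (\<Sum>k | 0 < k \<and> k < p \<and> even k. c k * int (p choose k)) / of_nat p) / of_nat p \<in> integral_at p"
    (is "(?S + ?X) / _ \<in> _")
proof -
  let ?K = "{k. 0 < k \<and> k < p \<and> even k}"
  have "?S = - (\<Sum>k\<in>?K. of_int (c k) * (- 1) ^ (k - 1) / of_nat k)"
    unfolding sum_negf[symmetric] by (rule sum.cong) auto
  moreover have "?X = (\<Sum>k\<in>?K. of_int (c k) * of_nat (p choose k) / of_nat p)"
    by (simp add: sum_divide_distrib)
  moreover have "?K \<subseteq> {0<..<p}" by auto
  ultimately show ?thesis using sum_choose_divide_prime[OF assms, of ?K c] by simp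
qed

lemma odd_harmonic_sum_cong:
  fixes c :: "nat \<Rightarrow> int"
  assumes "prime p"
  shows "((\<Sum>k | 0 < k \<and> k < p \<and> odd k. of_int (c k) / of_nat k)
    - of_int (\<Sum>k | 0 < k \<and> k < p \<and> odd k. c k * int (p choose k)) / of_nat p) / of_nat p \<in> integral_at p"
    (is "(?S - ?X) / _ \<in> _")
proof -
  let ?K = "{k. 0 < k \<and> k < p \<and> odd k}"
  have "?S = (\<Sum>k\<in>?K. of_int (c k) * (- 1) ^ (k - 1) / of_nat k)"
    by (rule sum.cong) auto
  moreover have "?X = (\<Sum>k\<in>?K. of_int (c k) * of_nat (p choose k) / of_nat p)"
    by (simp add: sum_divide_distrib)
  moreover have "?K \<subseteq> {0<..<p}" by auto
  ultimately have "(?X - ?S) / of_nat p \<in> integral_at p"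
    using sum_choose_divide_prime[OF assms, of ?K c] by simp
  from integral_at_uminus[OF this] show ?thesis by (simp add: minus_divide_left)
qed

section \<open>The Fermat quotient of 2\<close>

definition fermat_quotient2 :: "nat \<Rightarrow> rat" where
  "fermat_quotient2 p = (2 ^ (p - 1) - 1) / of_nat p"

text \<open>By Fermat's little theorem the quotient is even an integer.\<close>

lemma integral_at_fermat_quotient2:
  assumes p: "prime p" "p > 2"
  shows "fermat_quotient2 p \<in> integral_at p"
proof -
  have "\<not> p dvd 2" using p by (auto dest: dvd_imp_le)
  then have "[2 ^ (p - 1) = 1] (mod p)" using fermat_theorem p(1) by blast
  then have "[int (2 ^ (p - 1)) = int 1] (mod int p)" by (simp only: cong_int_iff)
  then obtain u where u: "2 ^ (p - 1) - 1 = int p * u" by (auto simp: cong_iff_dvd_diff)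
  have "(2 ^ (p - 1) - 1 :: rat) = of_int (int p * u)" by (simp flip: u)
  then have "fermat_quotient2 p = of_int u"
    using p by (simp add: fermat_quotient2_def)
  then show ?thesis using integral_at_of_int[OF p(1)] by simp
qed

text \<open>The even entries of row \<open>p\<close> add up to \<open>2 ^ (p - 1)\<close>; removing
  the end term 1 leaves \<open>p\<close> times the Fermat quotient.\<close>

lemma even_harmonic_sum:
  assumes p: "prime p" "p > 2"
  shows "((\<Sum>k | 0 < k \<and> k < p \<and> even k. 1 / of_nat k) - (- fermat_quotient2 p)) / of_nat p
    \<in> integral_at p"
proof -
  let ?X = "\<Sum>k | 0 < k \<and> k < p \<and> even k. int (p choose k)"
  have "2 * (\<Sum>k\<le>p. if even k then int (p choose k) else 0) = 2 ^ p"
    using choose_even_sum[of p, where 'a = int] p by simp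
  moreover have "(\<Sum>k\<le>p. if even k then int (p choose k) else 0) = 1 + ?X"
    using sum_even_choose_prime[OF p, of "\<lambda>_. 1"] by (simp add: sum.inter_filter[symmetric])
  ultimately have "1 + ?X = 2 ^ (p - 1)"
    using p by (cases p) auto
  then have "?X = 2 ^ (p - 1) - 1" by simp
  then show ?thesis
    using even_harmonic_sum_cong[OF p(1), of "\<lambda>_. 1"] by (simp add: fermat_quotient2_def del: of_int_sum)
qed

lemma odd_harmonic_sum:
  assumes p: "prime p" "p > 2"
  shows "((\<Sum>k | 0 < k \<and> k < p \<and> odd k. 1 / of_nat k) - fermat_quotient2 p) / of_nat p
    \<in> integral_at p"
proof -
  let ?X = "\<Sum>k | 0 < k \<and> k < p \<and> odd k. int (p choose k)"
  have "2 * (\<Sum>k\<le>p. if odd k then int (p choose k) else 0) = 2 ^ p"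
    using choose_odd_sum[of p, where 'a = int] p by simp
  moreover have "(\<Sum>k\<le>p. if odd k then int (p choose k) else 0) = 1 + ?X"
    using sum_odd_choose_prime[OF p, of "\<lambda>_. 1"] by (simp add: sum.inter_filter[symmetric])
  ultimately have "1 + ?X = 2 ^ (p - 1)"
    using p by (cases p) auto
  then have "?X = 2 ^ (p - 1) - 1" by simp
  then show ?thesis
    using odd_harmonic_sum_cong[OF p(1), of "\<lambda>_. 1"] by (simp add: fermat_quotient2_def del: of_int_sum)
qed

text \<open>With \<open>X = p * Y\<close>, expanding the square gives the Fermat quotient as
  \<open>2 * e * Y + p * Y\<^sup>2\<close>. Multiplying by \<open>- e / 2\<close> and using
  \<open>e\<^sup>2 = 1\<close> yields \<open>- Y\<close> modulo \<open>p\<close>, which is also the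
  residue of \<open>S\<close>. Only \<open>e\<close> has to be known, not the sign of the root
  \<open>e + X\<close>.\<close>

lemma fermat_quotient2_square_root:
  fixes e X :: int and S :: rat
  assumes p: "prime p" "p > 2" and e: "e\<^sup>2 = 1" and root: "(e + X)\<^sup>2 = 2 ^ (p - 1)"
    and X: "int p dvd X" and S: "(S + of_int X / of_nat p) / of_nat p \<in> integral_at p"
  shows "(S - (- (1 / 2)) * of_int e * fermat_quotient2 p) / of_nat p \<in> integral_at p"
proof -
  obtain Y where Y: "X = int p * Y" using X by blast
  have p0: "(of_nat p :: rat) \<noteq> 0" using p by simp
  have "of_nat p * fermat_quotient2 p = (of_int (e + X))\<^sup>2 - 1"
    using arg_cong[OF root, of "of_int :: int \<Rightarrow> rat"] p0 by (simp add: fermat_quotient2_def)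
  also have "\<dots> = of_nat p * (2 * of_int e * of_int Y + of_nat p * (of_int Y)\<^sup>2)"
    using arg_cong[OF e, of "of_int :: int \<Rightarrow> rat"] by (simp add: Y power2_eq_square algebra_simps)
  finally have q: "fermat_quotient2 p = 2 * of_int e * of_int Y + of_nat p * (of_int Y)\<^sup>2"
    using p0 by simp
  have e': "(of_int e :: rat) * of_int e = 1"
    using arg_cong[OF e, of "of_int :: int \<Rightarrow> rat"] by (simp add: power2_eq_square)
  \<comment> \<open>The product of \<open>e\<close> with itself is left standing here;
    \<open>e'\<close> turns it into 1 in the next step.\<close>
  have "S - (- (1 / 2)) * of_int e * fermat_quotient2 p
    = S + (of_int e * of_int e) * of_int Y + of_nat p * (of_int (e * Y\<^sup>2) / of_int 2)"
    unfolding q by (simp add: field_simps)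
  then have "(S - (- (1 / 2)) * of_int e * fermat_quotient2 p) / of_nat p
    = (S + of_int X / of_nat p) / of_nat p + of_int (e * Y\<^sup>2) / of_int 2"
    using p0 unfolding e' by (simp add: Y field_simps)
  moreover have "\<not> int p dvd 2" using p by (auto dest: zdvd_imp_le)
  ultimately show ?thesis
    using integral_at_add[OF p(1) S integral_at_divide] by metis
qed

lemma prime_dvd_sum_choose:
  assumes "prime p" and "K \<subseteq> {0<..<p}"
  shows "int p dvd (\<Sum>k\<in>K. c k * int (p choose k))"
proof (intro dvd_sum dvd_mult)
  fix k assume "k \<in> K"
  then have "p dvd p choose k" using assms by (intro dvd_choose_prime) auto
  then show "int p dvd int (p choose k)" by (simp only: int_dvd_int_iff)
qed

lemma even_alternating_harmonic_sum:
  assumes p: "prime p" "p > 2"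
  shows "((\<Sum>k | 0 < k \<and> k < p \<and> even k. (- 1) ^ (k div 2) / of_nat k)
    - (- (1 / 2)) * fermat_quotient2 p) / of_nat p \<in> integral_at p"
proof -
  define X where "X = (\<Sum>k | 0 < k \<and> k < p \<and> even k. (- 1) ^ (k div 2) * int (p choose k))"
  have "odd p" using p by (simp add: prime_odd_nat)
  then obtain m where "p = 2 * m + 1" by (elim oddE)
  \<comment> \<open>The end term at \<open>k = 0\<close> is 1, so the square root lemma is applied
    with \<open>e = 1\<close>.\<close>
  then have "(1 + X)\<^sup>2 = 2 ^ (p - 1)"
    using alternating_binomial_sum_squared(1)[of m]
      sum_even_choose_prime[OF p, of "\<lambda>k. (- 1) ^ (k div 2)"] by (simp add: X_def)
  moreover have "int p dvd X"
    unfolding X_def by (intro prime_dvd_sum_choose p) auto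
  ultimately show ?thesis
    using fermat_quotient2_square_root[OF p, of 1 X]
      even_harmonic_sum_cong[OF p(1), of "\<lambda>k. (- 1) ^ (k div 2)", folded X_def] by simp
qed

lemma odd_alternating_harmonic_sum:
  assumes p: "prime p" "p > 2"
  shows "((\<Sum>k | 0 < k \<and> k < p \<and> odd k. (- 1) ^ ((k + 1) div 2) / of_nat k)
    - (- (1 / 2)) * (- 1) ^ ((p - 1) div 2) * fermat_quotient2 p) / of_nat p \<in> integral_at p"
    (is "(?S - _) / _ \<in> _")
proof -
  define X where "X = (\<Sum>k | 0 < k \<and> k < p \<and> odd k. (- 1) ^ (k div 2) * int (p choose k))"
  \<comment> \<open>This is the end term at \<open>k = p\<close>; since \<open>p\<close> is odd,
    \<open>p div 2\<close> equals \<open>(p - 1) div 2\<close>.\<close>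
  define e :: int where "e = (- 1) ^ (p div 2)"
  have "odd p" using p by (simp add: prime_odd_nat)
  then obtain m where m: "p = 2 * m + 1" by (elim oddE)
  then have e: "of_int e = ((- 1) ^ ((p - 1) div 2) :: rat)" by (simp add: e_def)
  have "(e + X)\<^sup>2 = 2 ^ (p - 1)"
    using alternating_binomial_sum_squared(2)[of m]
      sum_odd_choose_prime[OF p, of "\<lambda>k. (- 1) ^ (k div 2)"] m by (simp add: X_def e_def)
  moreover have "e\<^sup>2 = 1" by (simp add: e_def flip: power_mult)
  moreover have "int p dvd X"
    unfolding X_def by (intro prime_dvd_sum_choose p) auto
  moreover have "(?S + of_int X / of_nat p) / of_nat p \<in> integral_at p"
  proof -
    let ?U = "\<Sum>k | 0 < k \<and> k < p \<and> odd k. of_int ((- 1) ^ (k div 2)) / of_nat k :: rat"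
    \<comment> \<open>For odd \<open>k\<close> the exponent \<open>(k + 1) div 2\<close> exceeds
      \<open>k div 2\<close> by one. The resulting sign turns the difference of
      \<open>odd_harmonic_sum_cong\<close> into the sum that the square root lemma expects.\<close>
    have "?S = - ?U"
      unfolding sum_negf[symmetric] by (rule sum.cong) (auto elim!: oddE)
    then have "(?S + of_int X / of_nat p) / of_nat p = - ((?U - of_int X / of_nat p) / of_nat p)"
      by (simp only: minus_divide_left) simp
    then show ?thesis
      using integral_at_uminus[OF odd_harmonic_sum_cong[OF p(1), of "\<lambda>k. (- 1) ^ (k div 2)", folded X_def]]
      by (simp only:)
  qed
  ultimately show ?thesis
    unfolding e[symmetric] by (intro fermat_quotient2_square_root[OF p])
qed

theorem proposition3p1:
  shows "S_A_1 = zeta2_A_1 \<and> zeta2_A_1 = \<ominus>\<^bsub>ring_A\<^esub> q2_A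
    \<and> zeta2_A_bar1 = S_A_bar1 \<and> S_A_bar1 = rat_A (- (1 / 2)) \<otimes>\<^bsub>ring_A\<^esub> q2_A
    \<and> t_A_1 = T_A_1 \<and> T_A_1 = q2_A
    \<and> t_A_bar1 = T_A_bar1
    \<and> T_A_bar1 = rat_A (- (1 / 2)) \<otimes>\<^bsub>ring_A\<^esub> sign_A \<otimes>\<^bsub>ring_A\<^esub> q2_A"
proof -
  have q2: "q2_A = class_A fermat_quotient2"
    by (simp add: q2_A_def fermat_quotient2_def[abs_def])
  note q_int = integral_at_fermat_quotient2
  have half: "- (1 / 2) \<in> integral_at p" if "prime p" "p > 2" for p
  proof -
    have "\<not> int p dvd 2" using that by (auto dest: zdvd_imp_le)
    then show ?thesis using integral_at_divide[of p 2 "- 1"] by simp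
  qed
  \<comment> \<open>The triple product associates to the left, so \<open>class_A_mult\<close> needs
    the first two factors as a single integral family.\<close>
  have half_sign: "- (1 / 2) * (- 1) ^ ((p - 1) div 2) \<in> integral_at p" if "prime p" "p > 2" for p
    using integral_at_mult[OF that(1) half[OF that] integral_at_of_int[OF that(1), of "(- 1) ^ ((p - 1) div 2)"]]
    by simp
  have sign: "(- 1) ^ ((p - 1) div 2) \<in> integral_at p" if "prime p" for p
    using integral_at_of_int[OF that, of "(- 1) ^ ((p - 1) div 2)"] by simp
  have neg_q: "\<ominus>\<^bsub>ring_A\<^esub> q2_A = class_A (\<lambda>p. - fermat_quotient2 p)"
    unfolding q2 by (intro class_A_uminus q_int)
  have half_q: "rat_A (- (1 / 2)) \<otimes>\<^bsub>ring_A\<^esub> q2_A = class_A (\<lambda>p. - (1 / 2) * fermat_quotient2 p)"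
    unfolding q2 rat_A_def by (intro class_A_mult half q_int)
  have half_sign_A: "rat_A (- (1 / 2)) \<otimes>\<^bsub>ring_A\<^esub> sign_A = class_A (\<lambda>p. - (1 / 2) * (- 1) ^ ((p - 1) div 2))"
    unfolding sign_A_def rat_A_def by (intro class_A_mult half sign)
  have half_sign_q: "rat_A (- (1 / 2)) \<otimes>\<^bsub>ring_A\<^esub> sign_A \<otimes>\<^bsub>ring_A\<^esub> q2_A
      = class_A (\<lambda>p. - (1 / 2) * (- 1) ^ ((p - 1) div 2) * fermat_quotient2 p)"
    unfolding half_sign_A q2 by (intro class_A_mult half_sign q_int)
  have "zeta2_A_1 = \<ominus>\<^bsub>ring_A\<^esub> q2_A"
    unfolding zeta2_A_1_def neg_q
    by (intro class_A_eqI integral_at_uminus q_int even_harmonic_sum)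
  moreover have "S_A_bar1 = rat_A (- (1 / 2)) \<otimes>\<^bsub>ring_A\<^esub> q2_A"
    unfolding S_A_bar1_def half_q
    by (intro class_A_eqI integral_at_mult half q_int even_alternating_harmonic_sum)
  moreover have "T_A_1 = q2_A"
    unfolding T_A_1_def q2
    by (intro class_A_eqI q_int odd_harmonic_sum)
  moreover have "T_A_bar1 = rat_A (- (1 / 2)) \<otimes>\<^bsub>ring_A\<^esub> sign_A \<otimes>\<^bsub>ring_A\<^esub> q2_A"
    unfolding T_A_bar1_def half_sign_q
    by (intro class_A_eqI integral_at_mult half_sign q_int odd_alternating_harmonic_sum)
  ultimately show ?thesis
    by (simp add: S_A_1_def zeta2_A_1_def S_A_bar1_def zeta2_A_bar1_def t_A_1_def T_A_1_def
        t_A_bar1_def T_A_bar1_def)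
qed

end
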